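(* Let $q$ be a prime power, let $n=q^m-1$, and let $i$ be an integer with $3\leq i\leq m-\left(\left\lfloor \frac{m-1}{2}\right\rfloor+\left\lfloor \frac{m-3}{3}\right\rfloor\right)$. Then the $i$-th largest $q$-cyclotomic coset leader modulo $n$ is $$\delta_{i,n}=(q-1)q^{m-1}-1-q^{\lfloor \frac{m-1}{2}\rfloor+i-2},$$ and $|C_{\delta_{i,n}}|=m$.
   Context: For $0\le t\le n-1$, the $q$-cyclotomic coset of $t$ modulo $n$ is $C_t=\{tq^j \bmod n : 0\le j<m\}\subseteq\{0,\dots,n-1\}$. The smallest element of $C_t$ is its coset leader. $\delta_{i,n}$ denotes the $i$-th largest element of the set of all $q$-cyclotomic coset leaders modulo $n$. $|C_t|$ is the number of elements of $C_t$.
   Formalization: The case q = 2, m = 2 is excluded: there i = 3 satisfies the bound, but n = 3 has only the coset leaders 0 and 1, so there is no third largest leader and the formula would give −1. *)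

theory Defs
  imports "HOL-Number_Theory.Number_Theory" "HOL-Number_Theory.Prime_Powers"
begin

(* Here m plays the role of the multiplicative order of q modulo n; the theorem takes
   n = q ^ m - 1.  Taking the modulus as a separate parameter keeps the definitions
   independent of that choice. *)

definition cyclotomic_coset :: "nat \<Rightarrow> nat \<Rightarrow> nat \<Rightarrow> nat \<Rightarrow> nat set" where
  "cyclotomic_coset q m n t = {(t * q ^ j) mod n | j. j < m}"

definition coset_leader :: "nat \<Rightarrow> nat \<Rightarrow> nat \<Rightarrow> nat \<Rightarrow> nat" where
  "coset_leader q m n t = Min (cyclotomic_coset q m n t)"

definition coset_leaders :: "nat \<Rightarrow> nat \<Rightarrow> nat \<Rightarrow> nat set" where
  "coset_leaders q m n = coset_leader q m n ` {0..<n}"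

(* The i-th largest coset leader, counted from i = 1; meaningful only for
   1 \<le> i \<le> card (coset_leaders q m n), since the list access is
   unspecified beyond its end. *)
definition delta :: "nat \<Rightarrow> nat \<Rightarrow> nat \<Rightarrow> nat \<Rightarrow> nat" where
  "delta q m n i = rev (sorted_list_of_set (coset_leaders q m n)) ! (i - 1)"

end

theory Submission
  imports Defs
begin

text \<open>
  Writing \<open>t = n - s\<close> complements the base-\<open>q\<close> digits, so multiplying \<open>t\<close> by \<open>q\<close> modulo \<open>n\<close>
  rotates the \<open>m\<close> digits of \<open>s\<close>, and \<open>t\<close> is a coset leader iff \<open>s\<close> is the largest among its
  rotations.  The \<open>i\<close>-th largest leader thus corresponds to the \<open>i\<close>-th smallest rotation-maximal
  digit string.  Such a string has a nonzero leading digit, and if that digit is 1 all digits are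
  at most 1.  Viewed cyclically, the gap following the leading 1 is the shortest of all gaps.  With
  two ones this allows \<open>q ^ (m - 1) + q ^ j\<close> exactly for \<open>j \<ge> (m - 1) div 2\<close>; with three or more
  ones the first gap is at most \<open>m div 3\<close>, and the bound on \<open>i\<close> keeps all such strings out of
  range.  Only for \<open>m = 2\<close> does the third string, \<open>2 * q\<close>, have a digit 2.
\<close>

section \<open>Digit rotations and multiplication by powers of \<open>q\<close> modulo
  \<open>n\<close>\<close>

text \<open>Cyclic left shift of the \<open>m\<close>-digit base-\<open>q\<close> string of
  \<open>s\<close>: the top \<open>c\<close> digits wrap around to the bottom.\<close>

definition rot :: "nat \<Rightarrow> nat \<Rightarrow> nat \<Rightarrow> nat \<Rightarrow> nat" where
  "rot q m s c = (s mod q ^ (m - c)) * q ^ c + s div q ^ (m - c)"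

definition rot_maximal :: "nat \<Rightarrow> nat \<Rightarrow> nat \<Rightarrow> bool" where
  "rot_maximal q m s \<longleftrightarrow> (\<forall>c<m. rot q m s c \<le> s)"

lemma rot_bounds:
  assumes "q > 0" "c \<le> m" "0 < s" "s < q ^ m"
  shows "0 < rot q m s c" "rot q m s c < q ^ m"
proof -
  have pow: "q ^ (m - c) * q ^ c = q ^ m"
    using assms(2) by (simp flip: power_add)
  have "s div q ^ (m - c) \<noteq> 0 \<or> s mod q ^ (m - c) \<noteq> 0"
    using \<open>0 < s\<close> by (metis div_mult_mod_eq add_0 mult_0 less_irrefl)
  then show "0 < rot q m s c"
    using \<open>q > 0\<close> by (auto simp: rot_def)
  have "s div q ^ (m - c) < q ^ c"
    using assms(4) pow by (intro less_mult_imp_div_less) (simp add: mult.commute)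
  moreover have "Suc (s mod q ^ (m - c)) * q ^ c \<le> q ^ (m - c) * q ^ c"
    using \<open>q > 0\<close> by (intro mult_right_mono) (auto simp: Suc_le_eq)
  ultimately show "rot q m s c < q ^ m"
    unfolding pow by (simp add: rot_def)
qed

text \<open>Modulo \<open>n\<close> the factor \<open>q ^ m\<close> is 1, so the top digits
  \<open>A\<close> pushed out by \<open>q ^ c\<close> reappear at the bottom and
  \<open>s * q ^ c\<close> is congruent to the rotation \<open>R\<close>. As \<open>R\<close> is
  positive and at most \<open>n\<close>, the residue of its negative is exactly
  \<open>n - R\<close>.\<close>

lemma complement_mult_power_mod:
  assumes "q > 0" "c \<le> m" "0 < s" "s < q ^ m"
  defines "n \<equiv> q ^ m - 1"
  shows "((n - s) * q ^ c) mod n = n - rot q m s c"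
proof -
  define A B R where "A = s div q ^ (m - c)" and "B = s mod q ^ (m - c)" and "R = rot q m s c"
  have R: "0 < R" "R \<le> n"
    using rot_bounds[OF assms(1-4)] by (auto simp: R_def n_def)
  have "s * q ^ c = (A * q ^ (m - c) + B) * q ^ c"
    by (simp only: A_def B_def div_mult_mod_eq)
  also have "\<dots> = A * q ^ m + B * q ^ c"
    using assms(2) by (simp add: add_mult_distrib mult.assoc flip: power_add)
  also have "\<dots> = A * n + R"
    using assms(1) by (simp add: R_def rot_def A_def B_def n_def diff_mult_distrib2)
  finally have "s * q ^ c = A * n + R" .
  moreover have "(n - s) * q ^ c + s * q ^ c = n * q ^ c"
    using assms(4) by (simp add: n_def flip: add_mult_distrib)
  \<comment> \<open>Multiples of \<open>n\<close> are added on both sides so that no truncated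
    subtraction disturbs the congruence.\<close>
  ultimately have "(n - s) * q ^ c + (A + 1) * n = n * q ^ c + (n - R)"
    using R(2) by (simp add: algebra_simps)
  then have "((n - s) * q ^ c + (A + 1) * n) mod n = (n * q ^ c + (n - R)) mod n"
    by simp
  then have "((n - s) * q ^ c) mod n = (n - R) mod n"
    by (simp only: mod_mult_self1 mod_mult_self3 add.commute[of "n * q ^ c"] mod_mult_self2)
  then show ?thesis
    using R by (simp add: R_def)
qed

text \<open>Exponents of \<open>q\<close> wrap around modulo \<open>m\<close>, so a coset, listed
  only for exponents below \<open>m\<close>, is closed under multiplication by
  \<open>q\<close>.\<close>

lemma mult_power_mod_reduce:
  fixes q m n t k :: nat
  assumes "q > 0" "n = q ^ m - 1"
  shows "t * q ^ k mod n = t * q ^ (k mod m) mod n"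
proof -
  have "[q ^ m = 1] (mod n)"
    using assms by (auto simp: cong_altdef_nat)
  then have "[(q ^ m) ^ (k div m) * (t * q ^ (k mod m)) = 1 ^ (k div m) * (t * q ^ (k mod m))] (mod n)"
    by (intro cong_mult cong_pow cong_refl)
  moreover have "(q ^ m) ^ (k div m) * (t * q ^ (k mod m)) = t * q ^ k"
    by (simp add: algebra_simps flip: power_mult power_add)
  ultimately show ?thesis
    by (simp add: cong_def)
qed

lemma finite_cyclotomic_coset [simp]: "finite (cyclotomic_coset q m n t)"
  by (simp add: cyclotomic_coset_def)

section \<open>Coset leaders and coset sizes in terms of rotations\<close>

text \<open>A leader \<open>t\<close> of the coset of \<open>u\<close> is itself some
  \<open>u * q ^ a mod n\<close>, so all its multiples by powers of \<open>q\<close> stay in that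
  coset, where \<open>t\<close> is minimal.\<close>

lemma coset_leaders_iff:
  assumes "q > 0" "m > 0" "n = q ^ m - 1"
  shows "t \<in> coset_leaders q m n \<longleftrightarrow> t < n \<and> (\<forall>c<m. t \<le> t * q ^ c mod n)"
proof (intro iffI conjI allI impI)
  assume "t \<in> coset_leaders q m n"
  then obtain u where u: "u < n" "t = Min (cyclotomic_coset q m n u)"
    by (auto simp: coset_leaders_def coset_leader_def)
  have "cyclotomic_coset q m n u \<noteq> {}"
    using assms(2) by (auto simp: cyclotomic_coset_def)
  then have "t \<in> cyclotomic_coset q m n u"
    using u by simp
  then obtain a where a: "t = u * q ^ a mod n"
    by (auto simp: cyclotomic_coset_def)
  then show "t < n"
    using u by simp
  fix c
  have "t * q ^ c mod n = u * q ^ (a + c) mod n"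
    by (simp add: a mod_mult_left_eq power_add mult.assoc)
  also have "\<dots> = u * q ^ ((a + c) mod m) mod n"
    using assms by (intro mult_power_mod_reduce)
  also have "\<dots> \<in> cyclotomic_coset q m n u"
    using assms(2) by (auto simp: cyclotomic_coset_def)
  finally show "t \<le> t * q ^ c mod n"
    using u by simp
next
  assume t: "t < n \<and> (\<forall>c<m. t \<le> t * q ^ c mod n)"
  then have "t \<in> cyclotomic_coset q m n t"
    using assms(2) by (auto simp: cyclotomic_coset_def intro!: exI[of _ 0])
  then have "Min (cyclotomic_coset q m n t) = t"
    using t by (intro Min_eqI) (auto simp: cyclotomic_coset_def)
  then show "t \<in> coset_leaders q m n"
    using t by (force simp: coset_leaders_def coset_leader_def)
qed

text \<open>Subtraction from \<open>n\<close> reverses the order, so minimality in the coset becomes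
  maximality among rotations.\<close>

lemma complement_coset_leader_iff:
  assumes "q > 0" "m > 0" "0 < s" "s < q ^ m"
  defines "n \<equiv> q ^ m - 1"
  shows "n - s \<in> coset_leaders q m n \<longleftrightarrow> rot_maximal q m s"
proof -
  have "n - s \<le> (n - s) * q ^ c mod n \<longleftrightarrow> rot q m s c \<le> s" if "c < m" for c
  proof -
    have "rot q m s c \<le> n" "s \<le> n"
      using rot_bounds[of q c m s] assms that by (auto simp: n_def)
    then show ?thesis
      using complement_mult_power_mod[of q c m s] assms that by (auto simp: n_def)
  qed
  moreover have "n - s < n"
    using assms by (auto simp: n_def)
  ultimately show ?thesis
    by (simp add: coset_leaders_iff[OF assms(1,2) n_def[THEN meta_eq_to_obj_eq]] rot_maximal_def)
qed

text \<open>As \<open>q\<close> is invertible modulo \<open>n\<close>, two equal entries of the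
  coset cancel to a nontrivial rotation fixing \<open>s\<close>.\<close>

lemma card_cyclotomic_coset_complement:
  assumes "q > 0" "0 < s" "s < q ^ m"
    and "\<And>c. 0 < c \<Longrightarrow> c < m \<Longrightarrow> rot q m s c \<noteq> s"
  defines "n \<equiv> q ^ m - 1"
  shows "card (cyclotomic_coset q m n (n - s)) = m"
proof (cases "m = 0")
  case True
  then show ?thesis
    by (simp add: cyclotomic_coset_def)
next
  case False
  have "coprime n q"
  proof -
    have "coprime (q ^ m - 1) (q ^ m)"
      using assms(1) by (intro coprime_diff_one_left_nat) simp
    then show ?thesis
      using False by (simp add: n_def)
  qed
  have "inj_on (\<lambda>c. (n - s) * q ^ c mod n) {..<m}"
  proof (rule linorder_inj_onI)
    fix a b
    assume ab: "a < b" "a \<in> {..<m}" "b \<in> {..<m}"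
    define c where "c = b - a"
    have c: "0 < c" "c < m" "b = c + a"
      using ab by (auto simp: c_def)
    show "(n - s) * q ^ a mod n \<noteq> (n - s) * q ^ b mod n"
    proof
      assume "(n - s) * q ^ a mod n = (n - s) * q ^ b mod n"
      then have "[(n - s) * q ^ a = (n - s) * q ^ c * q ^ a] (mod n)"
        by (simp add: cong_def c(3) power_add mult.assoc)
      then have "[n - s = (n - s) * q ^ c] (mod n)"
        using \<open>coprime n q\<close> by (subst (asm) cong_mult_rcancel_nat) (auto simp: coprime_commute)
      then have "n - s = n - rot q m s c"
        using complement_mult_power_mod[of q c m s] assms c by (simp add: cong_def n_def)
      moreover have "rot q m s c \<le> n" "s \<le> n"
        using rot_bounds[of q c m s] assms c by (auto simp: n_def)
      ultimately show False
        using assms(4)[OF c(1,2)] by simp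
    qed
  qed auto
  moreover have "cyclotomic_coset q m n (n - s) = (\<lambda>c. (n - s) * q ^ c mod n) ` {..<m}"
    by (auto simp: cyclotomic_coset_def)
  ultimately show ?thesis
    by (simp add: card_image)
qed

section \<open>Classification of small rotation-maximal strings\<close>

text \<open>Supplies the position \<open>e\<close> of the leading nonzero digit.\<close>

lemma power_bracket:
  fixes q s :: nat
  assumes "q \<ge> 2" "s > 0"
  obtains e where "q ^ e \<le> s" "s < q ^ Suc e"
proof -
  have "\<exists>e. q ^ e \<le> s \<and> s < q ^ (e + 1)"
    using assms by (intro ex_power_ivl1) auto
  then show ?thesis
    using that by auto
qed

text \<open>The shift that carries the digit at position \<open>e\<close> to the top position
  \<open>m - 1\<close>.\<close>

lemma rot_digit_to_front:
  assumes "e < m" "q > 0"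
  shows "rot q m s (m - 1 - e) = (s mod q ^ Suc e) * q ^ (m - 1 - e) + s div q ^ Suc e"
proof -
  have "m - (m - 1 - e) = Suc e"
    using assms by simp
  then show ?thesis
    unfolding rot_def by simp
qed

text \<open>If the top digit were 0, bringing the first nonzero digit to the front would multiply
  \<open>s\<close> by a power of \<open>q\<close> above 1.\<close>

lemma rot_maximal_ge:
  assumes "q \<ge> 2" "0 < s" "rot_maximal q m s" "m > 0"
  shows "q ^ (m - 1) \<le> s"
proof (rule ccontr)
  assume less: "\<not> ?thesis"
  obtain e where e: "q ^ e \<le> s" "s < q ^ Suc e"
    using power_bracket assms by metis
  have "q ^ e < q ^ (m - 1)"
    using e less by simp
  then have "e < m - 1"
    using assms(1) by (simp add: power_strict_increasing_iff)
  then have "rot q m s (m - 1 - e) = s * q ^ (m - 1 - e)"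
    using assms e rot_digit_to_front[of e m q s] by (simp del: power_Suc)
  moreover have "rot q m s (m - 1 - e) \<le> s"
    using assms(3,4) by (simp add: rot_maximal_def)
  ultimately have "s * q ^ (m - 1 - e) \<le> s"
    by simp
  moreover have "q ^ (m - 1 - e) > 1"
    using \<open>e < m - 1\<close> assms(1) by (intro one_less_power) auto
  ultimately show False
    using assms(2) by simp
qed

text \<open>Turns estimates that lose a factor 2 into comparisons of digit positions.\<close>

lemma power_less_twice_imp_le:
  fixes q a b :: nat
  assumes "q \<ge> 2" "q ^ a < 2 * q ^ b"
  shows "a \<le> b"
proof -
  have "2 * q ^ b \<le> q ^ Suc b"
    using assms(1) by simp
  then have "q ^ a < q ^ Suc b"
    using assms(2) by linarith
  then show ?thesis
    using assms(1) by (subst (asm) power_strict_increasing_iff) auto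
qed

text \<open>Let \<open>j\<close> be the second nonzero position and \<open>d\<close> its distance
  from the top. A third nonzero digit would leave three cyclic gaps, each at least \<open>d\<close>,
  so \<open>3 * d\<close> would be at most \<open>m\<close>; but \<open>j < k\<close> and
  \<open>3 * k < 2 * m\<close> exclude this.\<close>

lemma rot_maximal_small_cases:
  assumes q: "q \<ge> 2" and "rot_maximal q m s" "0 < s" "s \<le> q ^ (m - 1) + q ^ k"
    and "k + 2 \<le> m" "3 * k < 2 * m" "(m - 1) div 2 \<le> k"
  shows "s = q ^ (m - 1) \<or> (\<exists>j\<in>{(m - 1) div 2..k}. s = q ^ (m - 1) + q ^ j)"
proof -
  have "q ^ (m - 1) \<le> s"
    using rot_maximal_ge assms by auto
  then obtain r where s: "s = q ^ (m - 1) + r"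
    using le_Suc_ex by blast
  have "r \<le> q ^ k"
    using assms s by simp
  have maxrot: "rot q m s c \<le> s" if "c < m" for c
    using that assms by (auto simp: rot_maximal_def)
  consider "r = 0" | "r = q ^ k" | "0 < r" "r < q ^ k"
    using \<open>r \<le> q ^ k\<close> by linarith
  then show ?thesis
  proof cases
    case 3
    obtain j where j: "q ^ j \<le> r" "r < q ^ Suc j"
      using power_bracket q 3 by metis
    have "q ^ j < q ^ k"
      using j 3 by simp
    then have "j < k"
      using q by (simp add: power_strict_increasing_iff)
    define d where "d = m - 1 - j"
    have d: "d > 0" "m = Suc j + d" "m - 1 = j + d" "m - 2 - j = d - 1"
      using \<open>j < k\<close> assms(5) by (auto simp: d_def)
    have sj: "s mod q ^ Suc j = r" "s div q ^ Suc j = q ^ (d - 1)"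
    proof -
      have "s = q ^ (d - 1) * q ^ Suc j + r"
        using d by (simp add: s add.commute flip: power_add power_Suc)
      then show "s mod q ^ Suc j = r" "s div q ^ Suc j = q ^ (d - 1)"
        using j q by (auto simp del: power_Suc)
    qed
    \<comment> \<open>Compare \<open>s\<close> with the rotation that brings digit \<open>j\<close>
      to the front.\<close>
    have 1: "r * q ^ d + q ^ (d - 1) \<le> q ^ j * q ^ d + r"
      using maxrot[of d] rot_digit_to_front[of j m q s] sj d q
      by (auto simp: s power_add d_def[symmetric])
    have "q ^ Suc j \<le> q ^ (j + d)"
      using d q by (intro power_increasing) auto
    then have "r * q ^ d < q ^ j * q ^ d + q ^ j * q ^ d"
      using 1 j q unfolding power_add by linarith
    then have "r * q ^ d < (2 * q ^ j) * q ^ d"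
      by (simp only: mult_2 add_mult_distrib)
    then have "r < 2 * q ^ j"
      using mult_less_cancel2 by blast
    \<comment> \<open>Digit \<open>j\<close> is now known to be 1; \<open>r'\<close> collects the
      digits below it.\<close>
    define r' where "r' = r - q ^ j"
    have r: "r = q ^ j + r'" "r' < q ^ j"
      using \<open>r < 2 * q ^ j\<close> j by (auto simp: r'_def)
    have 2: "r' * q ^ d + q ^ (d - 1) \<le> r"
      using 1 unfolding r(1) by (simp add: add_mult_distrib)
    have "r' = 0"
    proof (rule ccontr)
      assume "r' \<noteq> 0"
      then obtain l where l: "q ^ l \<le> r'" "r' < q ^ Suc l"
        using power_bracket[of q r'] q by auto
      have "q ^ l < q ^ j"
        using l r by simp
      then have "l < j"
        using q by (simp add: power_strict_increasing_iff)
      have "q ^ (l + d) < 2 * q ^ j"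
      proof -
        have "q ^ (l + d) \<le> r' * q ^ d"
          using l by (simp add: power_add)
        then show ?thesis
          using 2 \<open>r < 2 * q ^ j\<close> by linarith
      qed
      \<comment> \<open>The gap from position \<open>j\<close> down to the third nonzero position
        \<open>l\<close> is at least \<open>d\<close>.\<close>
      then have "l + d \<le> j"
        using q power_less_twice_imp_le by blast
      have sl: "s mod q ^ Suc l = r'" "s div q ^ Suc l = q ^ (m - 2 - l) + q ^ (j - 1 - l)"
      proof -
        have "s = (q ^ (m - 2 - l) + q ^ (j - 1 - l)) * q ^ Suc l + r'"
          using d \<open>l < j\<close> by (simp add: s r(1) add_mult_distrib flip: power_add power_Suc)
        then show "s mod q ^ Suc l = r'"
             "s div q ^ Suc l = q ^ (m - 2 - l) + q ^ (j - 1 - l)"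
          using l q by (auto simp del: power_Suc)
      qed
      have "l < m" "m - 1 - l < m"
        using \<open>l < j\<close> d by auto
      \<comment> \<open>Bringing digit \<open>l\<close> to the front puts the original leading 1 at
        position \<open>m - 2 - l\<close>; this bounds the wrap-around gap \<open>l + 1\<close>
        below by \<open>d\<close>.\<close>
      then have "r' * q ^ (m - 1 - l) + q ^ (m - 2 - l) \<le> q ^ (m - 1) + r"
        using maxrot[of "m - 1 - l"] rot_digit_to_front[of l m q s] sl q
        by (auto simp: s)
      moreover have "q ^ (m - 1) \<le> r' * q ^ (m - 1 - l)"
      proof -
        have "q ^ (m - 1) = q ^ l * q ^ (m - 1 - l)"
          using \<open>l < j\<close> d by (simp flip: power_add)
        then show ?thesis
          using l by simp
      qed
      ultimately have "q ^ (m - 2 - l) < 2 * q ^ j"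
        using \<open>r < 2 * q ^ j\<close> by linarith
      then have "m - 2 - l \<le> j"
        using q power_less_twice_imp_le by blast
      then show False
        using \<open>l + d \<le> j\<close> \<open>j < k\<close> d assms(5,6) by linarith
    qed
    \<comment> \<open>With only two ones, the wrap-around gap \<open>j + 1\<close> must be at least
      \<open>d\<close>.\<close>
    then have "q ^ (d - 1) \<le> q ^ j"
      using 2 r by simp
    then have "d - 1 \<le> j"
      using q by (subst (asm) power_increasing_iff) auto
    then have "(m - 1) div 2 \<le> j"
      using d by linarith
    then show ?thesis
      using \<open>j < k\<close> \<open>r' = 0\<close> r s by auto
  qed (use s assms in auto)
qed

section \<open>Rotation-maximality of one and two powers\<close>

text \<open>Only the rotation bringing digit \<open>j\<close> to the front again has top digit 1,
  and its second one sits at \<open>m - 2 - j\<close>. All other nontrivial rotations have top digit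
  0. The strict version yields cosets of full size.\<close>

lemma rot_two_powers:
  assumes q: "q \<ge> 2" and "j + 2 \<le> m" "m - 2 - j \<le> j" "c < m" "0 < c"
  defines "s \<equiv> q ^ (m - 1) + q ^ j"
  shows "rot q m s c \<le> s" "m - 2 - j < j \<Longrightarrow> rot q m s c < s"
proof -
  define e where "e = m - 1 - c"
  have e: "m = Suc e + c"
    using assms by (simp add: e_def)
  \<comment> \<open>Handles rotations with top digit 0. Equality can occur for \<open>q = 2\<close>;
    strictness then comes from \<open>q ^ (m - 1) < s\<close>.\<close>
  have small: "q ^ a + q ^ b \<le> q ^ (m - 1)" if "a + 2 \<le> m" "b + 2 \<le> m" for a b
  proof -
    have "q ^ a \<le> q ^ (m - 2)" "q ^ b \<le> q ^ (m - 2)"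
      using that q by (auto intro!: power_increasing)
    moreover have "2 * q ^ (m - 2) \<le> q ^ Suc (m - 2)"
      using q by simp
    moreover have "Suc (m - 2) = m - 1"
      using that by simp
    ultimately show ?thesis
      by simp
  qed
  have rot: "rot q m s c = (s mod q ^ Suc e) * q ^ c + s div q ^ Suc e"
    using rot_digit_to_front[of e m q s] q by (simp add: e)
  have strict: "q ^ (m - 1) < s"
    using q by (simp add: s_def)
  consider "e < j" | "e = j" | "e > j"
    by linarith
  then have "rot q m s c \<le> s \<and> (m - 2 - j < j \<longrightarrow> rot q m s c < s)"
  proof cases
    case 1
    have "s = (q ^ (c - 1) + q ^ (j - Suc e)) * q ^ Suc e"
      using 1 e assms by (simp add: s_def add_mult_distrib flip: power_add power_Suc)
    then have "rot q m s c = q ^ (c - 1) + q ^ (j - Suc e)"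
      using q unfolding rot by (simp del: power_Suc)
    moreover have "\<dots> \<le> q ^ (m - 1)"
      using 1 e assms by (intro small) auto
    ultimately show ?thesis
      using strict by linarith
  next
    case 2
    have "s = q ^ (c - 1) * q ^ Suc e + q ^ e"
      using 2 e assms by (simp add: s_def flip: power_add power_Suc)
    moreover have "q ^ e < q ^ Suc e"
      using q by simp
    ultimately have "s mod q ^ Suc e = q ^ e" "s div q ^ Suc e = q ^ (c - 1)"
      using q by (auto simp del: power_Suc)
    then have "rot q m s c = q ^ (m - 1) + q ^ (m - 2 - j)"
      using 2 e unfolding rot by (simp flip: power_add)
    then show ?thesis
      using q assms by (auto simp: s_def intro!: power_increasing power_strict_increasing)
  next
    case 3
    have "s = q ^ (c - 1) * q ^ Suc e + q ^ j"
      using 3 e assms by (simp add: s_def flip: power_add power_Suc)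
    moreover have "q ^ j < q ^ Suc e"
      using q 3 by (intro power_strict_increasing) auto
    ultimately have "s mod q ^ Suc e = q ^ j" "s div q ^ Suc e = q ^ (c - 1)"
      using q by (auto simp del: power_Suc)
    then have "rot q m s c = q ^ (j + c) + q ^ (c - 1)"
      unfolding rot by (simp add: power_add)
    moreover have "\<dots> \<le> q ^ (m - 1)"
      using 3 e assms by (intro small) auto
    ultimately show ?thesis
      using strict by linarith
  qed
  then show "rot q m s c \<le> s" "m - 2 - j < j \<Longrightarrow> rot q m s c < s"
    by auto
qed

lemma rot_0: "s < q ^ m \<Longrightarrow> rot q m s 0 = s"
  by (simp add: rot_def)

lemma two_powers_less:
  fixes q m j :: nat
  assumes "q \<ge> 2" "j + 2 \<le> m"
  shows "q ^ (m - 1) + q ^ j < q ^ m"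
proof -
  have "q ^ j < q ^ (m - 1)"
    using assms by (intro power_strict_increasing) auto
  moreover have "2 * q ^ (m - 1) \<le> q ^ Suc (m - 1)"
    using assms(1) unfolding power_Suc by (intro mult_right_mono) auto
  moreover have "Suc (m - 1) = m"
    using assms(2) by simp
  ultimately show ?thesis
    by (simp del: power_Suc)
qed

lemma rot_maximal_two_powers:
  assumes "q \<ge> 2" "j + 2 \<le> m" "m - 2 - j \<le> j"
  shows "rot_maximal q m (q ^ (m - 1) + q ^ j)"
  unfolding rot_maximal_def
proof (intro allI impI)
  fix c
  assume "c < m"
  then show "rot q m (q ^ (m - 1) + q ^ j) c \<le> q ^ (m - 1) + q ^ j"
    using assms rot_two_powers(1)[of q j m c] two_powers_less[of q j m]
    by (cases "c = 0") (auto simp: rot_0)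
qed

lemma rot_maximal_power:
  assumes "q \<ge> 2" "m > 0"
  shows "rot_maximal q m (q ^ (m - 1))"
  unfolding rot_maximal_def
proof (intro allI impI)
  fix c
  assume c: "c < m"
  show "rot q m (q ^ (m - 1)) c \<le> q ^ (m - 1)"
  proof (cases "c = 0")
    case True
    then show ?thesis
      using assms by (simp add: rot_0)
  next
    case False
    have eq: "q ^ (m - 1) = q ^ (c - 1) * q ^ (m - c)"
      using c False by (simp flip: power_add)
    have "rot q m (q ^ (m - 1)) c = q ^ (c - 1)"
      using assms(1) unfolding rot_def eq by simp
    also have "\<dots> \<le> q ^ (m - 1)"
      using assms c by (intro power_increasing) auto
    finally show ?thesis .
  qed
qed

section \<open>Counting rotation-maximal strings\<close>

lemma rot_maximal_set_eq:
  assumes "q \<ge> 2" "k + 2 \<le> m" "3 * k < 2 * m" "(m - 1) div 2 \<le> k"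
  shows "{s. 0 < s \<and> s \<le> q ^ (m - 1) + q ^ k \<and> rot_maximal q m s} =
    insert (q ^ (m - 1)) ((\<lambda>j. q ^ (m - 1) + q ^ j) ` {(m - 1) div 2..k})"
proof (intro equalityI subsetI)
  fix s
  assume "s \<in> {s. 0 < s \<and> s \<le> q ^ (m - 1) + q ^ k \<and> rot_maximal q m s}"
  then show "s \<in> insert (q ^ (m - 1)) ((\<lambda>j. q ^ (m - 1) + q ^ j) ` {(m - 1) div 2..k})"
    using rot_maximal_small_cases[of q m s k] assms by auto
next
  fix s
  assume "s \<in> insert (q ^ (m - 1)) ((\<lambda>j. q ^ (m - 1) + q ^ j) ` {(m - 1) div 2..k})"
  then consider "s = q ^ (m - 1)"
    | j where "(m - 1) div 2 \<le> j" "j \<le> k" "s = q ^ (m - 1) + q ^ j"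
    by auto
  then show "s \<in> {s. 0 < s \<and> s \<le> q ^ (m - 1) + q ^ k \<and> rot_maximal q m s}"
  proof cases
    case 1
    then show ?thesis
      using rot_maximal_power[of q m] assms by auto
  next
    case 2
    have "m - 2 - j \<le> j"
      using 2 by linarith
    then show ?thesis
      using rot_maximal_two_powers[of q j m] assms 2 by (auto intro: power_increasing)
  qed
qed

lemma card_rot_maximal_set:
  assumes "q \<ge> 2" "k + 2 \<le> m" "3 * k < 2 * m" "(m - 1) div 2 \<le> k"
  shows "card {s. 0 < s \<and> s \<le> q ^ (m - 1) + q ^ k \<and> rot_maximal q m s} = k + 2 - (m - 1) div 2"
proof -
  have "inj_on (\<lambda>j. q ^ (m - 1) + q ^ j) {(m - 1) div 2..k}"
    using assms(1) by (auto intro!: inj_onI dest: power_inject_exp[THEN iffD1, rotated])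
  moreover have "q ^ (m - 1) \<notin> (\<lambda>j. q ^ (m - 1) + q ^ j) ` {(m - 1) div 2..k}"
    using assms(1) by auto
  ultimately show ?thesis
    unfolding rot_maximal_set_eq[OF assms] using assms(4) by (simp add: card_image)
qed

lemma rot_maximal_2_iff:
  assumes "s < q ^ 2"
  shows "rot_maximal q 2 s \<longleftrightarrow> s mod q * q + s div q \<le> s"
proof -
  have "rot_maximal q 2 s \<longleftrightarrow> rot q 2 s 0 \<le> s \<and> rot q 2 s 1 \<le> s"
    unfolding rot_maximal_def using less_2_cases by fastforce
  moreover have "rot q 2 s 0 = s" "rot q 2 s 1 = s mod q * q + s div q"
    using assms by (simp_all add: rot_def)
  ultimately show ?thesis
    by simp
qed

text \<open>A two-digit string is rotation-maximal iff its low digit does not exceed its high digit.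
  The assumption \<open>q \<ge> 3\<close> makes 2 a valid digit.\<close>

lemma card_rot_maximal_set_2:
  assumes q: "q \<ge> 3"
  shows "card {s. 0 < s \<and> s \<le> 2 * q \<and> rot_maximal q 2 s} = 3"
proof -
  have sq: "2 * q < q ^ 2"
    using q by (simp add: power2_eq_square)
  have "{s. 0 < s \<and> s \<le> 2 * q \<and> rot_maximal q 2 s} = {q, q + 1, 2 * q}"
  proof (intro equalityI subsetI)
    fix s
    assume "s \<in> {s. 0 < s \<and> s \<le> 2 * q \<and> rot_maximal q 2 s}"
    then have s: "0 < s" "s \<le> 2 * q" "s mod q * q + s div q \<le> s"
      using rot_maximal_2_iff[of s q] sq by auto
    consider "s < q" | "q \<le> s" "s < 2 * q" | "s = 2 * q"
      using s by linarith
    then show "s \<in> {q, q + 1, 2 * q}"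
    proof cases
      case 1
      then show ?thesis
        using s q by simp
    next
      case 2
      define b where "b = s - q"
      have b: "s = q + b" "b < q"
        using 2 by (auto simp: b_def)
      then have "b * q + 1 \<le> q + b"
        using s q by simp
      \<comment> \<open>The difference of the two sides is \<open>(b - 2) * (q - 1)\<close>; this
        contradicts the preceding bound.\<close>
      moreover have "2 * q + b \<le> b * q + 2" if "b \<ge> 2"
      proof -
        obtain x where "b = x + 2"
          using \<open>b \<ge> 2\<close> by (metis add.commute le_Suc_ex)
        moreover have "x \<le> x * q"
          using q by simp
        ultimately show ?thesis
          by (simp add: add_mult_distrib)
      qed
      ultimately have "b < 2"
        using q by linarith
      then show ?thesis
        using b by auto
    qed auto
  next
    fix s
    assume "s \<in> {q, q + 1, 2 * q}"
    moreover have "(q + 1) div q = 1"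
      using q by (intro div_nat_eqI) auto
    moreover have "(q + 1) mod q = 1"
      using q by (simp only: mod_add_self1) simp
    ultimately show "s \<in> {s. 0 < s \<and> s \<le> 2 * q \<and> rot_maximal q 2 s}"
      using q sq by (auto simp: rot_maximal_2_iff)
  qed
  then show ?thesis
    using q by simp
qed

section \<open>From counting to the \<open>i\<close>-th largest leader\<close>

text \<open>In the ascending list the elements from \<open>x\<close> on form the tail starting at
  the index of \<open>x\<close>, so the tail length is the rank of \<open>x\<close> from above,
  counted from 1.\<close>

lemma rev_sorted_list_of_set_nth:
  fixes L :: "'a :: linorder set"
  assumes "finite L" "x \<in> L"
  shows "rev (sorted_list_of_set L) ! (card {y \<in> L. x \<le> y} - 1) = x"
proof -
  define xs where "xs = sorted_list_of_set L"
  have xs: "set xs = L" "sorted xs" "distinct xs"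
    using assms by (auto simp: xs_def)
  then obtain p where p: "p < length xs" "xs ! p = x"
    using assms(2) by (metis in_set_conv_nth)
  have "{y \<in> L. x \<le> y} = (!) xs ` {p..<length xs}"
  proof (intro equalityI subsetI)
    fix y
    assume "y \<in> {y \<in> L. x \<le> y}"
    then obtain i where i: "i < length xs" "xs ! i = y" "x \<le> y"
      using xs(1) by (auto simp: in_set_conv_nth)
    have "p \<le> i"
    proof (rule ccontr)
      assume "\<not> p \<le> i"
      then have "xs ! i \<le> xs ! p"
        using xs(2) p(1) by (auto intro: sorted_nth_mono)
      then have "xs ! i = xs ! p"
        using i p by simp
      then show False
        using xs(3) i(1) p(1) \<open>\<not> p \<le> i\<close> by (simp add: nth_eq_iff_index_eq)
    qed
    then show "y \<in> (!) xs ` {p..<length xs}"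
      using i by auto
  qed (use xs p in \<open>auto intro: sorted_nth_mono\<close>)
  moreover have "inj_on ((!) xs) {p..<length xs}"
    using xs(3) by (auto intro: inj_on_nth)
  ultimately have "card {y \<in> L. x \<le> y} = length xs - p"
    by (simp add: card_image)
  then show ?thesis
    using p unfolding xs_def[symmetric] by (simp add: rev_nth)
qed

text \<open>The map \<open>u\<close> to \<open>n - u\<close> is a bijection from the
  rotation-maximal \<open>u \<le> s\<close> onto the leaders at least \<open>n - s\<close>, so
  counting the former gives the rank of \<open>n - s\<close>.\<close>

lemma delta_eq_complement:
  assumes "q > 0" "m > 0" "0 < s" "s < q ^ m" "rot_maximal q m s"
    and "card {u. 0 < u \<and> u \<le> s \<and> rot_maximal q m u} = i"
  defines "n \<equiv> q ^ m - 1"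
  shows "i \<le> card (coset_leaders q m n)" "delta q m n i = n - s"
proof -
  let ?L = "coset_leaders q m n"
  have fin: "finite ?L"
    by (simp add: coset_leaders_def)
  have mem: "n - s \<in> ?L"
    using complement_coset_leader_iff[of q m s] assms by simp
  have "{y \<in> ?L. n - s \<le> y} = (\<lambda>u. n - u) ` {u. 0 < u \<and> u \<le> s \<and> rot_maximal q m u}"
  proof (intro equalityI subsetI)
    fix y
    assume y: "y \<in> {y \<in> ?L. n - s \<le> y}"
    then have "y < n"
      using coset_leaders_iff[of q m n y] assms by auto
    then have u: "0 < n - y" "n - y \<le> s" "n - y < q ^ m" "y = n - (n - y)"
      using y by (auto simp: n_def)
    then have "rot_maximal q m (n - y)"
      using complement_coset_leader_iff[of q m "n - y"] assms y by (simp add: n_def[symmetric])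
    then show "y \<in> (\<lambda>u. n - u) ` {u. 0 < u \<and> u \<le> s \<and> rot_maximal q m u}"
      using u by blast
  next
    fix y
    assume "y \<in> (\<lambda>u. n - u) ` {u. 0 < u \<and> u \<le> s \<and> rot_maximal q m u}"
    then show "y \<in> {y \<in> ?L. n - s \<le> y}"
      using complement_coset_leader_iff[of q m] assms by (auto simp: n_def)
  qed
  moreover have "inj_on (\<lambda>u. n - u) {u. 0 < u \<and> u \<le> s \<and> rot_maximal q m u}"
    using assms by (auto simp: n_def intro!: inj_onI)
  ultimately have card: "card {y \<in> ?L. n - s \<le> y} = i"
    using assms by (simp add: card_image)
  have "card {y \<in> ?L. n - s \<le> y} \<le> card ?L"
    using fin by (intro card_mono) auto
  then show "i \<le> card ?L"
    using card by simp
  show "delta q m n i = n - s"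
    using rev_sorted_list_of_set_nth[OF fin mem] card by (simp add: delta_def)
qed

theorem lemma9:
  fixes q m n i :: nat
  assumes "primepow q"
    and "m \<ge> 1"
    and "n = q ^ m - 1"
    and "3 \<le> i"
    and "int i \<le> int m - ((int m - 1) div 2 + (int m - 3) div 3)"
    and "\<not> (q = 2 \<and> m = 2)"
  shows "i \<le> card (coset_leaders q m n)
    \<and> int (delta q m n i)
        = (int q - 1) * int q ^ (m - 1) - 1 - int q ^ ((m - 1) div 2 + i - 2)
    \<and> card (cyclotomic_coset q m n (delta q m n i)) = m"
proof -
  define k where "k = (m - 1) div 2 + i - 2"
  define s where "s = q ^ (m - 1) + q ^ k"
  have q: "q \<ge> 2"
    using primepow_gt_Suc_0[OF assms(1)] by simp
  have h: "int ((m - 1) div 2) = (int m - 1) div 2"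
    using assms(2) by (simp add: zdiv_int of_nat_diff)
  have s: "s < q ^ m \<and> rot_maximal q m s \<and>
      card {u. 0 < u \<and> u \<le> s \<and> rot_maximal q m u} = i \<and>
      (\<forall>c. 0 < c \<longrightarrow> c < m \<longrightarrow> rot q m s c \<noteq> s)"
  proof (cases "m = 2")
    case True
    \<comment> \<open>Here \<open>(int m - 3) div 3\<close> is -1, so the upper bound on
      \<open>i\<close> is 3.\<close>
    have "i = 3"
      using assms(4,5) True by simp
    have q3: "q \<ge> 3"
      using q assms(6) True by auto
    \<comment> \<open>Both powers have exponent 1, so they merge into a single digit 2.\<close>
    have s: "s = 2 * q"
      using True \<open>i = 3\<close> by (simp add: s_def k_def)
    have sq: "2 * q < q ^ 2"
      using q3 by (simp add: power2_eq_square)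
    have "rot_maximal q 2 (2 * q)"
      using rot_maximal_2_iff[of "2 * q" q] sq q by simp
    moreover have "rot q 2 (2 * q) 1 \<noteq> 2 * q"
      using q by (simp add: rot_def)
    moreover have "c = 1" if "0 < c" "c < 2" for c :: nat
      using that by simp
    ultimately show ?thesis
      using card_rot_maximal_set_2[OF q3] sq \<open>i = 3\<close> unfolding s True by blast
  next
    case False
    have m: "m > 2"
      using assms(2,4,5) False by (cases "m = 1") auto
    \<comment> \<open>The bound on \<open>i\<close> amounts to
      \<open>k \<le> m - 1 - m div 3\<close>, which gives both upper bounds on \<open>k\<close>; the
      first inequality is \<open>i \<ge> 3\<close>.\<close>
    have k: "(m - 1) div 2 < k" "k + 2 - (m - 1) div 2 = i" "3 * k < 2 * m" "k + 2 \<le> m"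
      using assms(4,5) m h unfolding k_def by linarith+
    have k': "m - 2 - k < k"
      using k(1) by linarith
    have "s < q ^ m"
      unfolding s_def using q k(4) by (rule two_powers_less)
    moreover have "rot_maximal q m s"
      unfolding s_def using q k(4) less_imp_le[OF k'] by (rule rot_maximal_two_powers)
    moreover have "card {u. 0 < u \<and> u \<le> s \<and> rot_maximal q m u} = i"
      unfolding s_def using card_rot_maximal_set[OF q k(4,3) less_imp_le[OF k(1)]] k(2) by simp
    moreover have "rot q m s c < s" if "0 < c" "c < m" for c
      unfolding s_def using rot_two_powers(2)[OF q k(4) less_imp_le[OF k'] that(2,1) k'] .
    ultimately show ?thesis
      by (simp add: less_imp_neq)
  qed
  have pos: "0 < s" "q > 0"
    using q by (auto simp: s_def)
  have delta: "i \<le> card (coset_leaders q m n)" "delta q m n i = n - s"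
    using delta_eq_complement[of q m s i] s pos assms(2,3) by auto
  have card: "card (cyclotomic_coset q m n (n - s)) = m"
    using card_cyclotomic_coset_complement[of q s m] s pos assms(3) by auto
  have "int (n - s) = int q ^ m - 1 - int s"
    using s assms(3) pos by (simp add: of_nat_diff)
  also have "int q ^ m = int q * int q ^ (m - 1)"
    using assms(2) by (simp flip: power_Suc)
  also have "int q * int q ^ (m - 1) - 1 - int s
      = (int q - 1) * int q ^ (m - 1) - 1 - int q ^ k"
    by (simp add: s_def algebra_simps)
  finally show ?thesis
    using delta card by (simp add: k_def)
qed

end
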